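(* Let $G$ be a graph of uniformicity $k$. Let $G'$, $G''$ and $G'''$ be graphs obtained from $G$ by applying one vertex deletion, one subgraph complementation or one bipartite complementation, respectively. Let $\ell'$, $\ell''$ and $\ell'''$ be the uniformicities of $G'$, $G''$ and $G'''$, respectively. Then the following three statements hold: (i) $\ell'\leq k\leq 2\ell'+1$; (ii) $\frac{k}{2}\leq \ell''\leq 2k$; (iii) $\frac{k}{3}\leq \ell'''\leq 3k$.
   Context: Graphs are undirected and simple, and finite except for the auxiliary infinite graphs $H$ and $H(K)$ below. Operations. Vertex deletion in a graph $G$: remove a single vertex $v$ from $G$, together with any edges incident to $v$. Subgraph complementation in $G$: choose a subset $S\subseteq V(G)$ and complement the subgraph of $G$ induced by $S$ (two distinct vertices of $S$ become adjacent iff they were non-adjacent; all other adjacencies are unchanged). Bipartite complementation in $G$: choose two disjoint subsets $X,Y\subseteq V(G)$ and complement the edges between $X$ and $Y$ ($x\in X$ and $y\in Y$ become adjacent iff they were non-adjacent; all other adjacencies are unchanged). Uniformicity. Let $k$ be a natural number, let $K$ be a symmetric $k\times k$ matrix with entries in $\{0,1\}$, and let $F_k$ be a graph on vertex set $\{1,\ldots,k\}$. Let $H$ be the disjoint union of (countably) infinitely many copies of $F_k$, and for $i=1,\ldots,k$ let $V_i$ be the subset of $V(H)$ containing vertex $i$ from each copy of $F_k$. Let $H(K)$ be the infinite graph on vertex set $V(H)$ in which two distinct vertices $u\in V_i$ and $v\in V_j$ (possibly $i=j$) are adjacent if and only if either $uv\in E(H)$ and $K(i,j)=0$, or $uv\notin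 E(H)$ and $K(i,j)=1$. Let $\mathcal{P}(K,F_k)$ be the class of all finite graphs isomorphic to induced subgraphs of $H(K)$. A graph $G$ is $k$-uniform if there exist such $K$ and $F_k$ with $G\in\mathcal{P}(K,F_k)$. The uniformicity of $G$ is the minimum $k$ such that $G$ is $k$-uniform. *)

theory Defs
  imports Complex_Main
begin

text \<open>
  Graphs are undirected and simple; they may be infinite, and the null graph is allowed.
\<close>

record 'a graph =
  verts :: "'a set"
  adj :: "'a \<Rightarrow> 'a \<Rightarrow> bool"

definition simple_graph :: "'a graph \<Rightarrow> bool" where
  "simple_graph G \<longleftrightarrow>
     (\<forall>u v. adj G u v \<longrightarrow> u \<in> verts G \<and> v \<in> verts G \<and> u \<noteq> v \<and> adj G v u)"

definition finite_graph :: "'a graph \<Rightarrow> bool" where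
  "finite_graph G \<longleftrightarrow> simple_graph G \<and> finite (verts G)"

definition induced_subgraph :: "'a graph \<Rightarrow> 'a set \<Rightarrow> 'a graph" where
  "induced_subgraph G W =
     \<lparr> verts = verts G \<inter> W, adj = (\<lambda>u v. u \<in> W \<and> v \<in> W \<and> adj G u v) \<rparr>"

definition isomorphic :: "'a graph \<Rightarrow> 'b graph \<Rightarrow> bool" where
  "isomorphic G H \<longleftrightarrow>
     (\<exists>f. bij_betw f (verts G) (verts H) \<and>
          (\<forall>u\<in>verts G. \<forall>v\<in>verts G. adj G u v \<longleftrightarrow> adj H (f u) (f v)))"

definition delete_vertex :: "'a graph \<Rightarrow> 'a \<Rightarrow> 'a graph" where
  "delete_vertex G v =
     \<lparr> verts = verts G - {v}, adj = (\<lambda>x y. x \<noteq> v \<and> y \<noteq> v \<and> adj G x y) \<rparr>"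

definition subgraph_complement :: "'a graph \<Rightarrow> 'a set \<Rightarrow> 'a graph" where
  "subgraph_complement G S =
     \<lparr> verts = verts G,
       adj = (\<lambda>x y. if x \<in> S \<and> y \<in> S \<and> x \<noteq> y then \<not> adj G x y else adj G x y) \<rparr>"

definition bipartite_complement :: "'a graph \<Rightarrow> 'a set \<Rightarrow> 'a set \<Rightarrow> 'a graph" where
  "bipartite_complement G X Y =
     \<lparr> verts = verts G,
       adj = (\<lambda>x y. if x \<in> X \<and> y \<in> Y \<or> x \<in> Y \<and> y \<in> X
                    then \<not> adj G x y else adj G x y) \<rparr>"

definition symmetric_01_matrix :: "nat \<Rightarrow> (nat \<Rightarrow> nat \<Rightarrow> nat) \<Rightarrow> bool" where
  "symmetric_01_matrix k K \<longleftrightarrow>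
     (\<forall>i\<in>{1..k}. \<forall>j\<in>{1..k}. K i j \<in> {0, 1} \<and> K i j = K j i)"

text \<open>
  The vertex \<open>(c, i)\<close> of the disjoint union of countably many copies of \<open>F\<close> is the vertex
  \<open>i\<close> of copy number \<open>c\<close>. Hence \<open>V\<^sub>i\<close> is the set of vertices with second component \<open>i\<close>.
\<close>

definition copies :: "nat graph \<Rightarrow> (nat \<times> nat) graph" where
  "copies F =
     \<lparr> verts = UNIV \<times> verts F,
       adj = (\<lambda>u v. fst u = fst v \<and> adj F (snd u) (snd v)) \<rparr>"

definition copies_twisted :: "(nat \<Rightarrow> nat \<Rightarrow> nat) \<Rightarrow> nat graph \<Rightarrow> (nat \<times> nat) graph" where
  "copies_twisted K F =
     \<lparr> verts = verts (copies F),
       adj = (\<lambda>u v. u \<in> verts (copies F) \<and> v \<in> verts (copies F) \<and> u \<noteq> v \<and>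
                (adj (copies F) u v \<and> K (snd u) (snd v) = 0 \<or>
                 \<not> adj (copies F) u v \<and> K (snd u) (snd v) = 1)) \<rparr>"

definition uniform_class :: "(nat \<Rightarrow> nat \<Rightarrow> nat) \<Rightarrow> nat graph \<Rightarrow> 'a graph set" where
  "uniform_class K F =
     {G. finite_graph G \<and>
         (\<exists>W \<subseteq> verts (copies_twisted K F). isomorphic G (induced_subgraph (copies_twisted K F) W))}"

definition uniform :: "nat \<Rightarrow> 'a graph \<Rightarrow> bool" where
  "uniform k G \<longleftrightarrow>
     (\<exists>K F. symmetric_01_matrix k K \<and> simple_graph F \<and> verts F = {1..k} \<and>
            G \<in> uniform_class K F)"

text \<open>
  The value \<open>k = 0\<close> is allowed; only the null graph is \<open>0\<close>-uniform.
\<close>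

definition uniformicity :: "'a graph \<Rightarrow> nat" where
  "uniformicity G = (LEAST k. uniform k G)"

text \<open>The minimum exists for every finite graph.\<close>

lemma uniform_card:
  assumes "finite_graph G"
  shows "uniform (card (verts G)) G"
proof -
  let ?n = "card (verts G)"
  from assms have fin: "finite (verts G)" and simp_G: "simple_graph G"
    by (auto simp: finite_graph_def)
  obtain f where f: "bij_betw f (verts G) {1..?n}"
    using fin by (metis bij_betw_iff_card card_atLeastAtMost diff_Suc_1 finite_atLeastAtMost)
  define g where "g = inv_into (verts G) f"
  have g: "g i \<in> verts G" if "i \<in> {1..?n}" for i
    using f that unfolding g_def by (metis bij_betw_def inv_into_into)
  have gf: "g (f u) = u" if "u \<in> verts G" for u
    using f that unfolding g_def by (simp add: bij_betw_inv_into_left)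
  have f_in: "f u \<in> {1..?n}" if "u \<in> verts G" for u
    using f that by (rule bij_betwE[rule_format])
  define F where
    "F = \<lparr> verts = {1..?n},
           adj = (\<lambda>i j. i \<in> {1..?n} \<and> j \<in> {1..?n} \<and> adj G (g i) (g j)) \<rparr>"
  let ?K = "\<lambda>_ _. 0 :: nat"
  let ?W = "{0} \<times> {1..?n}"
  have F: "simple_graph F" "verts F = {1..?n}"
    using simp_G unfolding simple_graph_def F_def by auto
  have W: "?W \<subseteq> verts (copies_twisted ?K F)"
    by (auto simp: copies_twisted_def copies_def F_def)
  have "bij_betw (\<lambda>u. (0 :: nat, f u)) (verts G) ?W"
    using f by (auto simp: bij_betw_def inj_on_def)
  moreover have "verts (induced_subgraph (copies_twisted ?K F) ?W) = ?W"
    using W by (auto simp: induced_subgraph_def)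
  moreover have "adj G u v \<longleftrightarrow>
      adj (induced_subgraph (copies_twisted ?K F) ?W) (0, f u) (0, f v)"
    if "u \<in> verts G" "v \<in> verts G" for u v
  proof -
    have "adj G u v \<Longrightarrow> f u \<noteq> f v"
      using that gf simp_G unfolding simple_graph_def by metis
    then show ?thesis
      using that f_in gf
      by (auto simp: induced_subgraph_def copies_twisted_def copies_def F_def)
  qed
  ultimately have "isomorphic G (induced_subgraph (copies_twisted ?K F) ?W)"
    unfolding isomorphic_def by (intro exI[of _ "\<lambda>u. (0, f u)"]) auto
  with assms W have "G \<in> uniform_class ?K F"
    unfolding uniform_class_def by blast
  with F show ?thesis
    unfolding uniform_def symmetric_01_matrix_def
    by (intro exI[of _ ?K] exI[of _ F]) auto
qed

lemma uniform_uniformicity: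
  assumes "finite_graph G"
  shows "uniform (uniformicity G) G"
  unfolding uniformicity_def using uniform_card[OF assms] by (rule LeastI)

end

theory Submission
  imports Defs
begin

text \<open>
  A finite graph is \<open>k\<close>-uniform iff its vertices carry a colour (one of \<open>k\<close>) and a block number,
  together injective, such that adjacency is given by a colour matrix \<open>K\<close>, corrected inside each
  block by a colour graph \<open>F\<close>. If adjacency is toggled according to a symmetric relation between
  \<open>d\<close> vertex classes, the refinement of the colouring by these classes absorbs the change into
  \<open>K\<close>, so uniformicity grows at most by the factor \<open>d\<close>. Subgraph complementation has the two
  classes \<open>S\<close> and its complement, bipartite complementation the three classes \<open>X\<close>, \<open>Y\<close> and the
  rest, and both are involutions, which gives the lower bounds. A deleted vertex is put back with a
  colour of its own after the other colours have been split into its neighbours and non-neighbours.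
\<close>

section \<open>Uniform graphs as graphs with colours and blocks\<close>

text \<open>For a vertex represented by \<open>(c, i)\<close> in \<open>copies_twisted\<close>,
  \<open>b\<close> is the copy \<open>c\<close> and \<open>t\<close> the index \<open>i\<close>;
  \<open>\<noteq>\<close> between Booleans is exclusive or. The colour type is arbitrary, so that
  refined colours can be pairs or options and need no renumbering.\<close>

definition uniform_coloring ::
  "'c set \<Rightarrow> ('c \<Rightarrow> 'c \<Rightarrow> bool) \<Rightarrow> ('c \<Rightarrow> 'c \<Rightarrow> bool) \<Rightarrow> ('a \<Rightarrow> nat) \<Rightarrow> ('a \<Rightarrow> 'c) \<Rightarrow> 'a graph \<Rightarrow> bool"
where
  "uniform_coloring C K F b t G \<longleftrightarrow>
     (\<forall>i j. K i j = K j i) \<and> (\<forall>i j. F i j = F j i) \<and> (\<forall>i. \<not> F i i) \<and>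
     t ` verts G \<subseteq> C \<and> inj_on (\<lambda>v. (b v, t v)) (verts G) \<and>
     (\<forall>u\<in>verts G. \<forall>v\<in>verts G. u \<noteq> v \<longrightarrow>
        adj G u v = (K (t u) (t v) \<noteq> (b u = b v \<and> F (t u) (t v))))"

text \<open>The two coordinates of an embedding into \<open>copies_twisted K F\<close> serve as
  block number and colour.\<close>

lemma uniformE:
  assumes "uniform k G"
  obtains K F b t where "uniform_coloring {1..k} K F b t G"
proof -
  from assms obtain K F W where K: "symmetric_01_matrix k K" and F: "simple_graph F"
    and VF: "verts F = {1..k}" and G: "finite_graph G"
    and W: "W \<subseteq> verts (copies_twisted K F)"
    and iso: "isomorphic G (induced_subgraph (copies_twisted K F) W)"
    unfolding uniform_def uniform_class_def by blast
  from iso obtain f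
    where f: "bij_betw f (verts G) (verts (induced_subgraph (copies_twisted K F) W))"
    and adj: "\<And>u v. u \<in> verts G \<Longrightarrow> v \<in> verts G \<Longrightarrow>
        adj G u v \<longleftrightarrow> adj (induced_subgraph (copies_twisted K F) W) (f u) (f v)"
    unfolding isomorphic_def by blast
  have fW: "f u \<in> W \<and> f u \<in> UNIV \<times> {1..k}" if "u \<in> verts G" for u
    using bij_betwE[OF f] that by (auto simp: induced_subgraph_def copies_twisted_def copies_def VF)
  have inj: "inj_on f (verts G)" using f by (rule bij_betw_imp_inj_on)
  \<comment> \<open>The matrix is cut off outside \<open>{1..k}\<close>, where
    \<open>symmetric_01_matrix\<close> says nothing but the colouring demands symmetry;
    \<open>adj F\<close> is symmetric everywhere already.\<close>
  have "uniform_coloring {1..k} (\<lambda>i j. i \<in> {1..k} \<and> j \<in> {1..k} \<and> K i j = 1) (adj F)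
      (\<lambda>v. fst (f v)) (\<lambda>v. snd (f v)) G"
    unfolding uniform_coloring_def
  proof (intro conjI ballI impI)
    fix u v assume uv: "u \<in> verts G" "v \<in> verts G" "u \<noteq> v"
    then have "f u \<noteq> f v" using inj by (auto simp: inj_on_def)
    \<comment> \<open>With entries restricted to 0 and 1, the two clauses of the twisted adjacency
      amount to an exclusive or.\<close>
    moreover have "K (snd (f u)) (snd (f v)) \<in> {0, 1}"
      using K fW[OF uv(1)] fW[OF uv(2)] unfolding symmetric_01_matrix_def mem_Times_iff by blast
    ultimately show "adj G u v = ((snd (f u) \<in> {1..k} \<and> snd (f v) \<in> {1..k} \<and>
          K (snd (f u)) (snd (f v)) = 1) \<noteq>
        (fst (f u) = fst (f v) \<and> adj F (snd (f u)) (snd (f v))))"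
      using adj[OF uv(1,2)] fW[OF uv(1)] fW[OF uv(2)]
      by (auto simp: induced_subgraph_def copies_twisted_def copies_def VF mem_Times_iff)
  next
    show "\<forall>i j. (i \<in> {1..k} \<and> j \<in> {1..k} \<and> K i j = 1) =
        (j \<in> {1..k} \<and> i \<in> {1..k} \<and> K j i = 1)"
      using K unfolding symmetric_01_matrix_def by fastforce
    show "\<forall>i j. adj F i j = adj F j i" "\<forall>i. \<not> adj F i i"
      using F unfolding simple_graph_def by blast+
    show "(\<lambda>v. snd (f v)) ` verts G \<subseteq> {1..k}"
      using fW by (auto simp: mem_Times_iff)
    show "inj_on (\<lambda>v. (fst (f v), snd (f v))) (verts G)"
      using inj by simp
  qed
  then show thesis by (rule that)
qed

text \<open>A numbering \<open>h\<close> of the colours turns \<open>(b v, t v)\<close> into a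
  vertex of \<open>copies\<close>; its inverse \<open>g\<close> carries \<open>K\<close> and
  \<open>F\<close> over to indices.\<close>

lemma uniformI:
  assumes G: "finite_graph G" and C: "finite C" "card C = k"
    and col: "uniform_coloring C K F b t G"
  shows "uniform k G"
proof -
  obtain h where h: "bij_betw h C {1..k}"
    using C by (metis bij_betw_iff_card card_atLeastAtMost diff_Suc_1 finite_atLeastAtMost)
  define g where "g = inv_into C h"
  have gh: "g (h i) = i" if "i \<in> C" for i
    using h that unfolding g_def by (simp add: bij_betw_inv_into_left)
  have hC: "h i \<in> {1..k}" if "i \<in> C" for i
    using h that by (rule bij_betwE[rule_format])
  from col have Ksym: "\<And>i j. K i j = K j i" and Fsym: "\<And>i j. F i j = F j i"
    and Firr: "\<And>i. \<not> F i i" and tC: "\<And>v. v \<in> verts G \<Longrightarrow> t v \<in> C"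
    and inj: "inj_on (\<lambda>v. (b v, t v)) (verts G)"
    and adj: "\<And>u v. u \<in> verts G \<Longrightarrow> v \<in> verts G \<Longrightarrow> u \<noteq> v \<Longrightarrow>
        adj G u v = (K (t u) (t v) \<noteq> (b u = b v \<and> F (t u) (t v)))"
    unfolding uniform_coloring_def by (blast, blast, blast, blast, blast, blast)
  define K' :: "nat \<Rightarrow> nat \<Rightarrow> nat" where "K' = (\<lambda>i j. if K (g i) (g j) then 1 else 0)"
  \<comment> \<open>Outside \<open>{1..k}\<close> the value of \<open>g\<close> is uncontrolled, and
    a simple graph may have edges only between its vertices.\<close>
  define F' where "F' = \<lparr> verts = {1..k},
    adj = (\<lambda>i j. i \<in> {1..k} \<and> j \<in> {1..k} \<and> F (g i) (g j)) \<rparr>"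
  let ?H = "copies_twisted K' F'"
  define f where "f = (\<lambda>v. (b v, h (t v)))"
  have K': "symmetric_01_matrix k K'"
    unfolding symmetric_01_matrix_def K'_def using Ksym by auto
  have F': "simple_graph F'" "verts F' = {1..k}"
    unfolding simple_graph_def F'_def using Fsym Firr by auto
  have W: "f ` verts G \<subseteq> verts ?H"
    using tC hC by (auto simp: f_def copies_twisted_def copies_def F'_def)
  have injf: "inj_on f (verts G)"
  proof (rule inj_onI)
    fix u v assume uv: "u \<in> verts G" "v \<in> verts G" "f u = f v"
    then have "b u = b v" "t u = t v"
      using gh tC unfolding f_def by (auto dest: arg_cong[where f = g])
    with inj uv show "u = v" by (auto dest: inj_onD)
  qed
  have "verts (induced_subgraph ?H (f ` verts G)) = f ` verts G"
    using W by (auto simp: induced_subgraph_def)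
  then have bij: "bij_betw f (verts G) (verts (induced_subgraph ?H (f ` verts G)))"
    using injf by (simp add: bij_betw_def)
  have "adj G u v \<longleftrightarrow> adj (induced_subgraph ?H (f ` verts G)) (f u) (f v)"
    if uv: "u \<in> verts G" "v \<in> verts G" for u v
  proof (cases "u = v")
    \<comment> \<open>The colouring is silent on the diagonal; neither graph has loops.\<close>
    case True
    then show ?thesis using G
      by (auto simp: finite_graph_def simple_graph_def induced_subgraph_def copies_twisted_def)
  next
    case False
    then have "f u \<noteq> f v" using injf uv by (auto dest: inj_onD)
    then show ?thesis
      using uv adj[OF uv False] hC[OF tC[OF uv(1)]] hC[OF tC[OF uv(2)]] gh[OF tC[OF uv(1)]]
        gh[OF tC[OF uv(2)]]
      by (auto simp: induced_subgraph_def copies_twisted_def copies_def F'_def K'_def f_def)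
  qed
  with bij have "isomorphic G (induced_subgraph ?H (f ` verts G))"
    unfolding isomorphic_def by blast
  with G W have "G \<in> uniform_class K' F'"
    unfolding uniform_class_def by blast
  with K' F' show ?thesis
    unfolding uniform_def by blast
qed

lemma uniformicity_le: "uniform k G \<Longrightarrow> uniformicity G \<le> k"
  unfolding uniformicity_def by (rule Least_le)

section \<open>Toggling adjacency between vertex classes\<close>

text \<open>With colours \<open>(s v, t v)\<close> the toggle depends on colours only, so it is
  added modulo 2 to the matrix, while blocks and block graph stay as they are.\<close>

lemma uniformicity_toggle_le:
  fixes G G' :: "'a graph" and s :: "'a \<Rightarrow> 'd" and M :: "'d \<Rightarrow> 'd \<Rightarrow> bool"
  assumes G: "finite_graph G" and G': "finite_graph G'" and V: "verts G' = verts G"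
    and D: "finite D" "s ` verts G \<subseteq> D" and M: "\<And>p q. M p q = M q p"
    and adj: "\<And>u v. u \<in> verts G \<Longrightarrow> v \<in> verts G \<Longrightarrow> u \<noteq> v \<Longrightarrow>
        adj G' u v = (adj G u v \<noteq> M (s u) (s v))"
  shows "uniformicity G' \<le> card D * uniformicity G"
proof -
  obtain K F b t where col: "uniform_coloring {1..uniformicity G} K F b t G"
    using uniform_uniformicity[OF G] by (rule uniformE)
  from col have Ksym: "\<And>i j. K i j = K j i" and Fsym: "\<And>i j. F i j = F j i"
    and Firr: "\<And>i. \<not> F i i" and t: "\<And>v. v \<in> verts G \<Longrightarrow> t v \<in> {1..uniformicity G}"
    and inj: "inj_on (\<lambda>v. (b v, t v)) (verts G)"
    and adjG: "\<And>u v. u \<in> verts G \<Longrightarrow> v \<in> verts G \<Longrightarrow> u \<noteq> v \<Longrightarrow>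
        adj G u v = (K (t u) (t v) \<noteq> (b u = b v \<and> F (t u) (t v)))"
    unfolding uniform_coloring_def by (blast, blast, blast, blast, blast, blast)
  have col': "uniform_coloring (D \<times> {1..uniformicity G})
      (\<lambda>p q. K (snd p) (snd q) \<noteq> M (fst p) (fst q)) (\<lambda>p q. F (snd p) (snd q))
      b (\<lambda>v. (s v, t v)) G'"
    unfolding uniform_coloring_def
  proof (intro conjI ballI impI allI)
    show "(K (snd p) (snd q) \<noteq> M (fst p) (fst q)) = (K (snd q) (snd p) \<noteq> M (fst q) (fst p))"
      for p q
      unfolding Ksym[of "snd p"] M[of "fst p"] ..
    show "F (snd p) (snd q) = F (snd q) (snd p)" "\<not> F (snd p) (snd p)" for p q
      by (rule Fsym, rule Firr)
    show "(\<lambda>v. (s v, t v)) ` verts G' \<subseteq> D \<times> {1..uniformicity G}"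
      using t D(2) unfolding V by blast
    show "inj_on (\<lambda>v. (b v, (s v, t v))) (verts G')"
      using inj unfolding V by (simp add: inj_on_def)
    show "adj G' u v =
        ((K (snd (s u, t u)) (snd (s v, t v)) \<noteq> M (fst (s u, t u)) (fst (s v, t v))) \<noteq>
          (b u = b v \<and> F (snd (s u, t u)) (snd (s v, t v))))"
      if "u \<in> verts G'" "v \<in> verts G'" "u \<noteq> v" for u v
      using that unfolding V by (simp add: adj adjG) blast
  qed
  have "uniform (card (D \<times> {1..uniformicity G})) G'"
    using D(1) by (intro uniformI[OF G' _ refl col']) simp
  from uniformicity_le[OF this] show ?thesis
    by (simp add: card_cartesian_product)
qed

section \<open>The two complementations\<close>

lemma finite_graph_subgraph_complement:
  assumes "finite_graph G" "S \<subseteq> verts G"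
  shows "finite_graph (subgraph_complement G S)"
proof -
  from assms(1) have "finite (verts G)"
    and mem: "\<And>u v. adj G u v \<Longrightarrow> u \<in> verts G \<and> v \<in> verts G"
    and irr: "\<And>u. \<not> adj G u u" and sym: "\<And>u v. adj G u v = adj G v u"
    unfolding finite_graph_def simple_graph_def by blast+
  with assms(2) show ?thesis
    unfolding finite_graph_def simple_graph_def subgraph_complement_def
    by (simp split: if_splits) (blast dest: mem)
qed

lemma subgraph_complement_involution:
  "subgraph_complement (subgraph_complement G S) S = G"
  unfolding subgraph_complement_def by (rule graph.equality) (auto simp: fun_eq_iff)

lemma uniformicity_subgraph_complement_le:
  assumes "finite_graph G" "S \<subseteq> verts G"
  shows "uniformicity (subgraph_complement G S) \<le> 2 * uniformicity G"
proof -
  have "uniformicity (subgraph_complement G S) \<le> card (UNIV :: bool set) * uniformicity G"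
    by (rule uniformicity_toggle_le[OF assms(1) finite_graph_subgraph_complement[OF assms],
          where s = "\<lambda>v. v \<in> S" and M = "(\<and>)"])
      (auto simp: subgraph_complement_def)
  then show ?thesis by simp
qed

text \<open>Disjointness prevents loops: a vertex in both \<open>X\<close> and \<open>Y\<close>
  would become adjacent to itself.\<close>

lemma finite_graph_bipartite_complement:
  assumes "finite_graph G" "X \<subseteq> verts G" "Y \<subseteq> verts G" "X \<inter> Y = {}"
  shows "finite_graph (bipartite_complement G X Y)"
  using assms unfolding finite_graph_def simple_graph_def bipartite_complement_def
  by (auto split: if_splits)

lemma bipartite_complement_involution:
  "bipartite_complement (bipartite_complement G X Y) X Y = G"
  unfolding bipartite_complement_def by (rule graph.equality) (auto simp: fun_eq_iff)

lemma uniformicity_bipartite_complement_le: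
  assumes "finite_graph G" "X \<subseteq> verts G" "Y \<subseteq> verts G" "X \<inter> Y = {}"
  shows "uniformicity (bipartite_complement G X Y) \<le> 3 * uniformicity G"
proof -
  \<comment> \<open>Classes 0, 1, 2 are \<open>X\<close>, \<open>Y\<close> and the rest; as
    \<open>X\<close> and \<open>Y\<close> are disjoint, testing \<open>X\<close> first misplaces no
    vertex of \<open>Y\<close>.\<close>
  let ?s = "\<lambda>v. if v \<in> X then 0 else if v \<in> Y then 1 else 2 :: nat"
  let ?M = "\<lambda>p q :: nat. p = 0 \<and> q = 1 \<or> p = 1 \<and> q = 0"
  have "uniformicity (bipartite_complement G X Y) \<le> card {0, 1, 2 :: nat} * uniformicity G"
    by (rule uniformicity_toggle_le[OF assms(1) finite_graph_bipartite_complement[OF assms],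
          where s = ?s and M = ?M])
      (use assms(4) in \<open>auto simp: bipartite_complement_def\<close>)
  then show ?thesis by simp
qed

section \<open>Vertex deletion\<close>

lemma finite_graph_delete_vertex:
  "finite_graph G \<Longrightarrow> finite_graph (delete_vertex G v)"
  unfolding finite_graph_def simple_graph_def delete_vertex_def by auto

text \<open>A colouring restricts to the remaining vertices.\<close>

lemma uniformicity_delete_vertex_le:
  assumes "finite_graph G"
  shows "uniformicity (delete_vertex G v) \<le> uniformicity G"
proof -
  obtain K F b t where "uniform_coloring {1..uniformicity G} K F b t G"
    using uniform_uniformicity[OF assms] by (rule uniformE)
  then have "uniform_coloring {1..uniformicity G} K F b t (delete_vertex G v)"
    by (auto simp: uniform_coloring_def delete_vertex_def inj_on_def)
  with finite_graph_delete_vertex[OF assms] show ?thesis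
    by (intro uniformicity_le uniformI) auto
qed

lemma uniformicity_le_delete_vertex:
  assumes G: "finite_graph G"
  shows "uniformicity G \<le> 2 * uniformicity (delete_vertex G v) + 1"
proof -
  define l where "l = uniformicity (delete_vertex G v)"
  have "uniform l (delete_vertex G v)"
    unfolding l_def using uniform_uniformicity[OF finite_graph_delete_vertex[OF G]] .
  then obtain K F b t where col: "uniform_coloring {1..l} K F b t (delete_vertex G v)"
    by (rule uniformE)
  \<comment> \<open>\<open>None\<close> is the colour of \<open>v\<close> alone; in
    \<open>Some (a, i)\<close> the flag \<open>a\<close> records adjacency to \<open>v\<close>, so
    it is also the matrix entry against \<open>None\<close>.\<close>
  define K' where "K' = (\<lambda>p q. case (p, q) of
      (Some (a, i), Some (a', j)) \<Rightarrow> K i j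
    | (Some (a, i), None) \<Rightarrow> a
    | (None, Some (a, i)) \<Rightarrow> a
    | (None, None) \<Rightarrow> False)"
  \<comment> \<open>\<open>None\<close> is isolated in the block graph, so the uncontrolled block
    number \<open>b v\<close> does no harm.\<close>
  define F' where "F' = (\<lambda>p q. case (p, q) of
      (Some (a :: bool, i), Some (a' :: bool, j)) \<Rightarrow> F i j | _ \<Rightarrow> False)"
  define t' where "t' = (\<lambda>u. if u = v then None else Some (adj G u v, t u))"
  let ?C = "insert None (Some ` ((UNIV :: bool set) \<times> {1..l}))"
  have sym: "adj G x y = adj G y x" for x y
    using G unfolding finite_graph_def simple_graph_def by blast
  have "uniform_coloring ?C K' F' b t' G"
    unfolding uniform_coloring_def
  proof (intro conjI ballI impI)
    show "\<forall>i j. K' i j = K' j i" "\<forall>i j. F' i j = F' j i" "\<forall>i. \<not> F' i i"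
      using col by (auto simp: uniform_coloring_def K'_def F'_def split: option.splits)
    show "t' ` verts G \<subseteq> ?C"
      using col by (auto simp: uniform_coloring_def t'_def delete_vertex_def)
    show "inj_on (\<lambda>v. (b v, t' v)) (verts G)"
      using col by (auto simp: uniform_coloring_def t'_def delete_vertex_def inj_on_def)
    show "adj G x y = (K' (t' x) (t' y) \<noteq> (b x = b y \<and> F' (t' x) (t' y)))"
      if "x \<in> verts G" "y \<in> verts G" "x \<noteq> y" for x y
      using col that sym[of v y]
      by (auto simp: uniform_coloring_def t'_def K'_def F'_def delete_vertex_def)
  qed
  moreover have "card ?C = 2 * l + 1"
    by (subst card_insert_disjoint) (auto simp: card_image card_cartesian_product)
  ultimately have "uniform (2 * l + 1) G"
    using G by (intro uniformI[of G ?C]) auto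
  then show ?thesis
    unfolding l_def by (rule uniformicity_le)
qed

section \<open>Upper and lower bounds combined\<close>

theorem lemma6:
  fixes G :: "'a graph" and k :: nat
  assumes "finite_graph G"
    and "uniformicity G = k"
  shows
    "(\<forall>v\<in>verts G. \<forall>l'. uniformicity (delete_vertex G v) = l' \<longrightarrow>
        l' \<le> k \<and> k \<le> 2 * l' + 1) \<and>
     (\<forall>S. S \<subseteq> verts G \<longrightarrow> (\<forall>l''. uniformicity (subgraph_complement G S) = l'' \<longrightarrow>
        real k / 2 \<le> real l'' \<and> l'' \<le> 2 * k)) \<and>
     (\<forall>X Y. X \<subseteq> verts G \<longrightarrow> Y \<subseteq> verts G \<longrightarrow> X \<inter> Y = {} \<longrightarrow>
        (\<forall>l'''. uniformicity (bipartite_complement G X Y) = l''' \<longrightarrow>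
           real k / 3 \<le> real l''' \<and> l''' \<le> 3 * k))"
proof (intro conjI allI ballI impI)
  fix v m
  assume m: "uniformicity (delete_vertex G v) = m"
  show "m \<le> k"
    using uniformicity_delete_vertex_le[OF assms(1), of v] m assms(2) by simp
  show "k \<le> 2 * m + 1"
    using uniformicity_le_delete_vertex[OF assms(1), of v] m assms(2) by simp
next
  fix S m
  assume S: "S \<subseteq> verts G" and m: "uniformicity (subgraph_complement G S) = m"
  have "S \<subseteq> verts (subgraph_complement G S)"
    using S by (simp add: subgraph_complement_def)
  \<comment> \<open>Complementing the complemented graph once more restores \<open>G\<close>, hence
    \<open>k \<le> 2 * m\<close>.\<close>
  from uniformicity_subgraph_complement_le[OF finite_graph_subgraph_complement[OF assms(1) S] this]
  show "real k / 2 \<le> real m"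
    using m assms(2) by (simp add: subgraph_complement_involution)
  show "m \<le> 2 * k"
    using uniformicity_subgraph_complement_le[OF assms(1) S] m assms(2) by simp
next
  fix X Y m
  assume XY: "X \<subseteq> verts G" "Y \<subseteq> verts G" "X \<inter> Y = {}"
    and m: "uniformicity (bipartite_complement G X Y) = m"
  have "X \<subseteq> verts (bipartite_complement G X Y)" "Y \<subseteq> verts (bipartite_complement G X Y)"
    using XY by (simp_all add: bipartite_complement_def)
  \<comment> \<open>Again the second application restores \<open>G\<close>, giving
    \<open>k \<le> 3 * m\<close>.\<close>
  from uniformicity_bipartite_complement_le
    [OF finite_graph_bipartite_complement[OF assms(1) XY] this XY(3)]
  show "real k / 3 \<le> real m"
    using m assms(2) by (simp add: bipartite_complement_involution)
  show "m \<le> 3 * k"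
    using uniformicity_bipartite_complement_le[OF assms(1) XY] m assms(2) by simp
qed

end
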